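(* Let $G$ be a (discrete) group and suppose that the reduced group $C^*$-algebra $C^*_\lambda(G)$ is just-infinite. Then either $C^*_\lambda(G)$ is simple, or $G$ is amenable.
   Context: A $C^*$-algebra $A$ is just-infinite if it is infinite dimensional and $A/I$ is finite dimensional for each non-zero closed two-sided ideal $I$ of $A$. $C^*_\lambda(G)$ is the norm closure of $\lambda(\mathbb{C}[G])$, where $\lambda$ is the left-regular representation of $G$ on $\ell^2(G)$. *)

theory Defs
  imports "HOL-Analysis.Analysis" "HOL-Library.Poly_Mapping" "HOL-Library.Set_Algebras"
begin

text \<open>
  Groups are types of class \<^class>\<open>group_add\<close>: the group operation is written additively but is
  not assumed to be commutative (the commutative class is \<^class>\<open>ab_group_add\<close>), so
  \<open>- g + x\<close> is $g^{-1}x$.  With this convention the library type \<open>'g \<Rightarrow>\<^sub>0 complex\<close> of finitely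
  supported functions, with its convolution product, is the complex group algebra of \<open>'g\<close>.
\<close>

section \<open>The Hilbert space of square-summable functions\<close>

typedef 'a ell2 = "{f :: 'a \<Rightarrow> complex. (\<lambda>x. (cmod (f x))\<^sup>2) summable_on UNIV}"
  by (rule exI[of _ "\<lambda>_. 0"]) simp

setup_lifting type_definition_ell2

lemma sq_summable_add:
  fixes f g :: "'a \<Rightarrow> complex"
  assumes "(\<lambda>x. (cmod (f x))\<^sup>2) summable_on UNIV" "(\<lambda>x. (cmod (g x))\<^sup>2) summable_on UNIV"
  shows "(\<lambda>x. (cmod (f x + g x))\<^sup>2) summable_on UNIV"
proof (rule summable_on_comparison_test)
  show "(\<lambda>x. 2 * (cmod (f x))\<^sup>2 + 2 * (cmod (g x))\<^sup>2) summable_on UNIV"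
    by (intro summable_on_add summable_on_cmult_right assms)
next
  fix x
  have "(cmod (f x + g x))\<^sup>2 \<le> (cmod (f x) + cmod (g x))\<^sup>2"
    by (intro power_mono norm_triangle_ineq norm_ge_zero)
  also have "\<dots> \<le> 2 * (cmod (f x))\<^sup>2 + 2 * (cmod (g x))\<^sup>2"
    using sum_squares_bound[of "cmod (f x)" "cmod (g x)"] by (simp add: power2_sum)
  finally show "(cmod (f x + g x))\<^sup>2 \<le> 2 * (cmod (f x))\<^sup>2 + 2 * (cmod (g x))\<^sup>2" .
qed auto

lemma sq_summable_scale:
  fixes f :: "'a \<Rightarrow> complex"
  assumes "(\<lambda>x. (cmod (f x))\<^sup>2) summable_on UNIV"
  shows "(\<lambda>x. (cmod (c * f x))\<^sup>2) summable_on UNIV"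
  using summable_on_cmult_right[OF assms, of "(cmod c)\<^sup>2"]
  by (simp add: norm_mult power_mult_distrib)

lemma inner_summable:
  fixes f g :: "'a \<Rightarrow> complex"
  assumes "(\<lambda>x. (cmod (f x))\<^sup>2) summable_on UNIV" "(\<lambda>x. (cmod (g x))\<^sup>2) summable_on UNIV"
  shows "(\<lambda>x. f x \<bullet> g x) summable_on UNIV"
proof -
  have "(\<lambda>x. norm (f x \<bullet> g x)) summable_on UNIV"
  proof (rule summable_on_comparison_test)
    show "(\<lambda>x. (cmod (f x))\<^sup>2 + (cmod (g x))\<^sup>2) summable_on UNIV"
      by (intro summable_on_add assms)
  next
    fix x
    have "norm (f x \<bullet> g x) \<le> cmod (f x) * cmod (g x)"
      using Cauchy_Schwarz_ineq2[of "f x" "g x"] by simp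
    also have "\<dots> \<le> (cmod (f x))\<^sup>2 + (cmod (g x))\<^sup>2"
      using sum_squares_bound[of "cmod (f x)" "cmod (g x)"]
        mult_nonneg_nonneg[OF norm_ge_zero[of "f x"] norm_ge_zero[of "g x"]] by linarith
    finally show "norm (f x \<bullet> g x) \<le> (cmod (f x))\<^sup>2 + (cmod (g x))\<^sup>2" .
  qed auto
  thus ?thesis by (rule abs_summable_summable)
qed

text \<open>
  The real inner product below is the real part of the usual inner product on $\ell^2$ (the
  library inner product of two complex numbers is $\mathrm{Re}(\overline{z}w)$); it induces the
  usual norm, see \<open>norm_ell2\<close>.  Complex scalars act through \<open>cmult\<close>.
\<close>

instantiation ell2 :: (type) real_inner
begin

lift_definition zero_ell2 :: "'a ell2" is "\<lambda>_. 0" by simp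
lift_definition plus_ell2 :: "'a ell2 \<Rightarrow> 'a ell2 \<Rightarrow> 'a ell2" is "\<lambda>f g x. f x + g x"
  by (rule sq_summable_add)
lift_definition uminus_ell2 :: "'a ell2 \<Rightarrow> 'a ell2" is "\<lambda>f x. - f x" by simp
lift_definition minus_ell2 :: "'a ell2 \<Rightarrow> 'a ell2 \<Rightarrow> 'a ell2" is "\<lambda>f g x. f x - g x"
  subgoal for f g using sq_summable_add[of f "\<lambda>x. - g x"] by simp
  done
lift_definition scaleR_ell2 :: "real \<Rightarrow> 'a ell2 \<Rightarrow> 'a ell2" is "\<lambda>r f x. complex_of_real r * f x"
  by (rule sq_summable_scale)
lift_definition inner_ell2 :: "'a ell2 \<Rightarrow> 'a ell2 \<Rightarrow> real" is "\<lambda>f g. \<Sum>\<^sub>\<infinity>x. f x \<bullet> g x" .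
definition norm_ell2 :: "'a ell2 \<Rightarrow> real" where "norm_ell2 f = sqrt (f \<bullet> f)"
definition sgn_ell2 :: "'a ell2 \<Rightarrow> 'a ell2" where "sgn_ell2 f = scaleR (inverse (norm f)) f"
definition dist_ell2 :: "'a ell2 \<Rightarrow> 'a ell2 \<Rightarrow> real" where "dist_ell2 f g = norm (f - g)"
definition uniformity_ell2 :: "('a ell2 \<times> 'a ell2) filter" where
  "uniformity_ell2 = (INF e\<in>{0<..}. principal {(x, y). dist x y < e})"
definition open_ell2 :: "'a ell2 set \<Rightarrow> bool" where
  "open_ell2 U \<longleftrightarrow> (\<forall>x\<in>U. eventually (\<lambda>(x', y). x' = x \<longrightarrow> y \<in> U) uniformity)"

instance
proof
  fix f g h :: "'a ell2" and r s :: real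
  show "f + g + h = f + (g + h)" by transfer (simp add: add.assoc)
  show "f + g = g + f" by transfer (simp add: add.commute)
  show "0 + f = f" by transfer simp
  show "- f + f = 0" by transfer simp
  show "f - g = f + - g" by transfer simp
  show "r *\<^sub>R (f + g) = r *\<^sub>R f + r *\<^sub>R g" by transfer (simp add: algebra_simps)
  show "(r + s) *\<^sub>R f = r *\<^sub>R f + s *\<^sub>R f" by transfer (simp add: algebra_simps)
  show "r *\<^sub>R s *\<^sub>R f = (r * s) *\<^sub>R f" by transfer (simp add: mult.assoc)
  show "1 *\<^sub>R f = f" by transfer simp
  show "dist f g = norm (f - g)" by (rule dist_ell2_def)
  show "sgn f = scaleR (inverse (norm f)) f" by (rule sgn_ell2_def)
  show "uniformity = (INF e\<in>{0<..}. principal {(x, y :: 'a ell2). dist x y < e})"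
    by (rule uniformity_ell2_def)
  show "open U \<longleftrightarrow> (\<forall>x\<in>U. eventually (\<lambda>(x', y). x' = x \<longrightarrow> y \<in> U) uniformity)"
    for U :: "'a ell2 set" by (rule open_ell2_def)
  show "f \<bullet> g = g \<bullet> f" by transfer (simp add: inner_commute)
  show "(f + g) \<bullet> h = f \<bullet> h + g \<bullet> h"
    by transfer (simp add: inner_add_left infsum_add inner_summable)
  show "r *\<^sub>R f \<bullet> g = r * (f \<bullet> g)"
  proof transfer
    fix r :: real and f g :: "'a \<Rightarrow> complex"
    have "(complex_of_real r * f x) \<bullet> g x = r * (f x \<bullet> g x)" for x
      by (metis inner_scaleR_left scaleR_conv_of_real)
    thus "(\<Sum>\<^sub>\<infinity>x. (complex_of_real r * f x) \<bullet> g x) = r * (\<Sum>\<^sub>\<infinity>x. f x \<bullet> g x)"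
      by (simp add: infsum_cmult_right')
  qed
  show "0 \<le> f \<bullet> f" by transfer (simp add: infsum_nonneg)
  show "f \<bullet> f = 0 \<longleftrightarrow> f = 0"
  proof transfer
    fix f :: "'a \<Rightarrow> complex"
    assume f: "(\<lambda>x. (cmod (f x))\<^sup>2) summable_on UNIV"
    show "(\<Sum>\<^sub>\<infinity>x. f x \<bullet> f x) = 0 \<longleftrightarrow> f = (\<lambda>_. 0)"
    proof
      assume "(\<Sum>\<^sub>\<infinity>x. f x \<bullet> f x) = 0"
      hence "f x \<bullet> f x = 0" for x
        using nonneg_infsum_le_0D[of "\<lambda>x. f x \<bullet> f x" UNIV x] inner_summable[OF f f] by simp
      thus "f = (\<lambda>_. 0)" by auto
    qed simp
  qed
  show "norm f = sqrt (f \<bullet> f)" by (rule norm_ell2_def)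
qed

end

lemma norm_ell2: "norm f = sqrt (\<Sum>\<^sub>\<infinity>x. (cmod (Rep_ell2 f x))\<^sup>2)"
  unfolding norm_ell2_def inner_ell2.rep_eq by (simp add: dot_square_norm)

section \<open>Operators\<close>

type_synonym 'a op = "'a ell2 \<Rightarrow>\<^sub>L 'a ell2"

lift_definition cmult_fun :: "complex \<Rightarrow> 'a ell2 \<Rightarrow> 'a ell2" is "\<lambda>c f x. c * f x"
  by (rule sq_summable_scale)

lemma norm_cmult_fun: "norm (cmult_fun c f) = cmod c * norm f"
  unfolding norm_ell2 cmult_fun.rep_eq
  by (simp add: norm_mult power_mult_distrib infsum_cmult_right' real_sqrt_mult)

lift_definition cmult :: "complex \<Rightarrow> 'a op" is cmult_fun
proof (rule bounded_linear_intro)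
  fix c :: complex and f g :: "'a ell2" and r :: real
  show "cmult_fun c (f + g) = cmult_fun c f + cmult_fun c g"
    by transfer (simp add: algebra_simps)
  show "cmult_fun c (r *\<^sub>R f) = r *\<^sub>R cmult_fun c f"
    by transfer (simp add: algebra_simps)
  show "norm (cmult_fun c f) \<le> norm f * cmod c"
    by (simp add: norm_cmult_fun)
qed

text \<open>
  The complex vector space structure on the bounded operators: \<open>(c \<cdot> T) f = c \<cdot> T f\<close>.  The type
  \<open>'a op\<close> also contains operators that are only real-linear; the algebras considered below
  consist of complex-linear operators, for which \<^const>\<open>norm\<close> on \<open>'a op\<close> is the usual operator
  norm.
\<close>

definition op_scale :: "complex \<Rightarrow> 'a op \<Rightarrow> 'a op"  (infixr "*\<^sub>O" 75) where
  "c *\<^sub>O T = cmult c o\<^sub>L T"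

global_interpretation op: vector_space op_scale
  defines op_span = "op.span" and op_subspace = "op.subspace"
proof
  fix c d :: complex and S T :: "'a op"
  show "c *\<^sub>O (S + T) = c *\<^sub>O S + c *\<^sub>O T"
    unfolding op_scale_def by (rule blinfun_eqI) (simp add: blinfun.add_left blinfun.add_right)
  show "(c + d) *\<^sub>O T = c *\<^sub>O T + d *\<^sub>O T"
    unfolding op_scale_def
    by (rule blinfun_eqI, simp add: blinfun.add_left cmult.rep_eq, transfer)
      (simp add: algebra_simps)
  show "c *\<^sub>O d *\<^sub>O T = (c * d) *\<^sub>O T"
    unfolding op_scale_def
    by (rule blinfun_eqI, simp add: cmult.rep_eq, transfer) (simp add: algebra_simps)
  show "1 *\<^sub>O T = T"
    unfolding op_scale_def by (rule blinfun_eqI, simp add: cmult.rep_eq, transfer) simp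
qed

section \<open>Ideals, simplicity and just-infiniteness\<close>

text \<open>
  In this section \<open>A\<close> is meant to be a C*-algebra of operators on an $\ell^2$-space, i.e. a
  norm-closed *-subalgebra.
\<close>

definition closed_ideal :: "'a op set \<Rightarrow> 'a op set \<Rightarrow> bool" where
  "closed_ideal A I \<longleftrightarrow> I \<subseteq> A \<and> closed I \<and> op_subspace I \<and>
     (\<forall>a\<in>A. \<forall>x\<in>I. a o\<^sub>L x \<in> I \<and> x o\<^sub>L a \<in> I)"

definition simple_cstar :: "'a op set \<Rightarrow> bool" where
  "simple_cstar A \<longleftrightarrow> A \<noteq> {0} \<and> (\<forall>I. closed_ideal A I \<longrightarrow> I = {0} \<or> I = A)"

definition finite_dim :: "'a op set \<Rightarrow> bool" where
  "finite_dim A \<longleftrightarrow> (\<exists>B. finite B \<and> B \<subseteq> A \<and> op_span B = A)"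

text \<open>
  The set \<open>A/I\<close> of cosets \<open>a + I\<close>.  It is finite dimensional iff it is spanned by finitely many
  cosets \<open>b + I\<close>, \<open>b \<in> B\<close>, i.e. iff every coset is of the form \<open>(\<Sum>b\<in>B. c\<^sub>b \<cdot> b) + I\<close>.
\<close>

definition quotient_space :: "'a op set \<Rightarrow> 'a op set \<Rightarrow> 'a op set set" where
  "quotient_space A I = (\<lambda>a. a +o I) ` A"

definition finite_dim_quotient :: "'a op set \<Rightarrow> 'a op set \<Rightarrow> bool" where
  "finite_dim_quotient A I \<longleftrightarrow>
     (\<exists>B. finite B \<and> B \<subseteq> A \<and> quotient_space A I = (\<lambda>s. s +o I) ` op_span B)"

definition just_infinite :: "'a op set \<Rightarrow> bool" where
  "just_infinite A \<longleftrightarrow> \<not> finite_dim A \<and>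
     (\<forall>I. closed_ideal A I \<and> I \<noteq> {0} \<longrightarrow> finite_dim_quotient A I)"

section \<open>The reduced group C*-algebra\<close>

lift_definition translate :: "'g::group_add \<Rightarrow> 'g ell2 \<Rightarrow> 'g ell2" is "\<lambda>g f x. f (- g + x)"
  subgoal for g f
    using summable_on_reindex_bij_betw[of "\<lambda>x. - g + x" UNIV UNIV "\<lambda>x. (cmod (f x))\<^sup>2"]
    by (simp add: bij_plus_right)
  done

lemma norm_translate: "norm (translate g f) = norm f"
  unfolding norm_ell2 translate.rep_eq
  using infsum_reindex_bij_betw[of "\<lambda>x. - g + x" UNIV UNIV "\<lambda>x. (cmod (Rep_ell2 f x))\<^sup>2"]
  by (simp add: bij_plus_right)

lift_definition left_reg :: "'g::group_add \<Rightarrow> 'g op" is translate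
proof (rule bounded_linear_intro)
  fix g :: 'g and f h :: "'g ell2" and r :: real
  show "translate g (f + h) = translate g f + translate g h" by transfer simp
  show "translate g (r *\<^sub>R f) = r *\<^sub>R translate g f" by transfer simp
  show "norm (translate g f) \<le> norm f * 1" by (simp add: norm_translate)
qed

text \<open>The linear extension of the left-regular representation to the group algebra.\<close>

definition left_reg_alg :: "('g::group_add \<Rightarrow>\<^sub>0 complex) \<Rightarrow> 'g op" where
  "left_reg_alg a = (\<Sum>g\<in>Poly_Mapping.keys a. Poly_Mapping.lookup a g *\<^sub>O left_reg g)"

definition reduced_cstar :: "'g::group_add op set" where
  "reduced_cstar = closure (range left_reg_alg)"

section \<open>Amenability\<close>

text \<open>A left-invariant mean on the bounded real functions on the group.\<close>

definition ell_infinity :: "('g \<Rightarrow> real) set" where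
  "ell_infinity = {f. bounded (range f)}"

definition invariant_mean :: "(('g::group_add \<Rightarrow> real) \<Rightarrow> real) \<Rightarrow> bool" where
  "invariant_mean m \<longleftrightarrow>
     (\<forall>f\<in>ell_infinity. \<forall>h\<in>ell_infinity. m (\<lambda>x. f x + h x) = m f + m h) \<and>
     (\<forall>c. \<forall>f\<in>ell_infinity. m (\<lambda>x. c * f x) = c * m f) \<and>
     (\<forall>f\<in>ell_infinity. (\<forall>x. 0 \<le> f x) \<longrightarrow> 0 \<le> m f) \<and>
     m (\<lambda>_. 1) = 1 \<and>
     (\<forall>g. \<forall>f\<in>ell_infinity. m (\<lambda>x. f (- g + x)) = m f)"

definition amenable :: "'g::group_add itself \<Rightarrow> bool" where
  "amenable _ \<longleftrightarrow> (\<exists>m :: ('g \<Rightarrow> real) \<Rightarrow> real. invariant_mean m)"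

end

theory Submission
  imports Defs
begin

text \<open>
  Let \<open>I\<close> be a nonzero proper closed ideal of the reduced C*-algebra \<open>A\<close>, so that \<open>A/I\<close> is
  finite dimensional. Then there are finitely many bounded real-linear coordinate functionals
  \<open>c b\<close> on \<open>A\<close> with \<open>a - (\<Sum>b. c b a *\<^sub>R b) \<in> I\<close> for all \<open>a\<close>. No \<open>left_reg g\<close> is close to \<open>I\<close>,
  since it is invertible and \<open>I\<close> is proper; hence \<open>\<Sum>b. (c b (left_reg g))\<^sup>2\<close> is bounded below
  uniformly in \<open>g\<close>.

  For a finite set \<open>S\<close> of group elements put \<open>\<rho> = norm (\<Sum>s\<in>S. left_reg s)\<close>. The sum
  \<open>a\<close> of \<open>c b (left_reg w) *\<^sub>R left_reg w\<close> over all words \<open>w\<close> of length \<open>n\<close> in \<open>S\<close> has norm at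
  most a constant times \<open>\<rho> ^ n\<close>, because the coefficients are bounded and the regular
  representation is positive. As \<open>c b a\<close> is the sum of the squares \<open>(c b (left_reg w))\<^sup>2\<close>, summing
  over \<open>b\<close> bounds \<open>card S ^ n\<close> by a constant times \<open>\<rho> ^ n\<close>, and letting \<open>n\<close> tend to infinity
  gives \<open>\<rho> \<ge> card S\<close>. So the regular representation has almost invariant unit vectors, and
  a cluster point of the means they define is an invariant mean.
\<close>

section \<open>Linear coordinates modulo a closed subspace of a normed space\<close>

text \<open>Since \<open>b \<notin> V\<close>, the coefficient of \<open>b\<close> is unique, which
  gives linearity. Since \<open>V\<close> is closed, \<open>b\<close> has positive distance from
  \<open>V\<close>, and the inverse of that distance bounds the coefficient.\<close>

lemma bounded_functional_adjoin:
  fixes V :: "'a::real_normed_vector set"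
  assumes V: "closed V" "subspace V" and b: "b \<notin> V"
  obtains k L where "\<And>x. x \<in> span (insert b V) \<Longrightarrow> x - k x *\<^sub>R b \<in> V"
    and "\<And>x y. x \<in> span (insert b V) \<Longrightarrow> y \<in> span (insert b V) \<Longrightarrow> k (x + y) = k x + k y"
    and "\<And>r x. x \<in> span (insert b V) \<Longrightarrow> k (r *\<^sub>R x) = r * k x"
    and "L \<ge> 0" and "\<And>x. x \<in> span (insert b V) \<Longrightarrow> \<bar>k x\<bar> \<le> L * norm x"
proof -
  let ?J = "span (insert b V)"
  define k where "k x = (SOME r. x - r *\<^sub>R b \<in> V)" for x
  have ne: "V \<noteq> {}" using subspace_0[OF V(2)] by auto
  define d where "d = infdist b V"
  have d: "d > 0" using infdist_pos_not_in_closed[OF V(1) ne b] by (simp add: d_def)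
  have k: "x - k x *\<^sub>R b \<in> V" if "x \<in> ?J" for x
  proof -
    have "\<exists>r. x - r *\<^sub>R b \<in> V"
      using that V(2) by (auto simp: span_breakdown_eq span_eq_iff[THEN iffD2, OF V(2)])
    thus ?thesis unfolding k_def by (rule someI_ex)
  qed
  have uniq: "r = s" if "x - r *\<^sub>R b \<in> V" "x - s *\<^sub>R b \<in> V" for x r s
  proof (rule ccontr)
    assume "r \<noteq> s"
    have "(x - s *\<^sub>R b) - (x - r *\<^sub>R b) \<in> V" using subspace_diff[OF V(2) that(2) that(1)] .
    hence "(r - s) *\<^sub>R b \<in> V" by (simp add: algebra_simps)
    hence "(1 / (r - s)) *\<^sub>R (r - s) *\<^sub>R b \<in> V" by (rule subspace_scale[OF V(2)])
    thus False using \<open>r \<noteq> s\<close> b by simp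
  qed
  have add: "k (x + y) = k x + k y" if "x \<in> ?J" "y \<in> ?J" for x y
  proof (rule uniq)
    show "(x + y) - k (x + y) *\<^sub>R b \<in> V" using k span_add that by blast
    have "(x - k x *\<^sub>R b) + (y - k y *\<^sub>R b) \<in> V" using k that subspace_add[OF V(2)] by blast
    thus "(x + y) - (k x + k y) *\<^sub>R b \<in> V" by (simp add: algebra_simps)
  qed
  have scale: "k (r *\<^sub>R x) = r * k x" if "x \<in> ?J" for r x
  proof (rule uniq)
    show "r *\<^sub>R x - k (r *\<^sub>R x) *\<^sub>R b \<in> V" using k span_scale that by blast
    have "r *\<^sub>R (x - k x *\<^sub>R b) \<in> V" using k that subspace_scale[OF V(2)] by blast
    thus "r *\<^sub>R x - (r * k x) *\<^sub>R b \<in> V" by (simp add: algebra_simps)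
  qed
  have bound: "\<bar>k x\<bar> \<le> inverse d * norm x" if "x \<in> ?J" for x
  proof (cases "k x = 0")
    case False
    \<comment> \<open>This point of \<open>V\<close> is \<open>b\<close> minus \<open>x\<close>
      divided by \<open>k x\<close>, so its distance from \<open>b\<close> is the norm of
      \<open>x\<close> divided by \<open>\<bar>k x\<bar>\<close>.\<close>
    have "- inverse (k x) *\<^sub>R (x - k x *\<^sub>R b) \<in> V"
      using k[OF that] subspace_scale[OF V(2)] by blast
    hence "d \<le> dist b (- inverse (k x) *\<^sub>R (x - k x *\<^sub>R b))"
      unfolding d_def by (rule infdist_le)
    also have "\<dots> = inverse \<bar>k x\<bar> * norm x"
      using False by (simp add: dist_norm algebra_simps)
    finally show ?thesis using d False by (simp add: field_simps)
  qed (use d in simp)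
  show ?thesis
    by (rule that[of k "inverse d"]) (use k add scale bound d in auto)
qed

text \<open>The coefficient of \<open>b\<close> is Lipschitz, so it converges along a convergent
  sequence. Subtracting the \<open>b\<close>-components leaves a convergent sequence in the closed
  set \<open>V\<close>.\<close>

lemma closed_span_insert:
  fixes V :: "'a::real_normed_vector set"
  assumes V: "closed V" "subspace V"
  shows "closed (span (insert b V))"
proof (cases "b \<in> V")
  case True
  hence "span (insert b V) = V" using V(2) by (simp add: insert_absorb span_eq_iff)
  thus ?thesis using V by simp
next
  case False
  let ?J = "span (insert b V)"
  obtain k L where k: "\<And>x. x \<in> ?J \<Longrightarrow> x - k x *\<^sub>R b \<in> V"
    and add: "\<And>x y. x \<in> ?J \<Longrightarrow> y \<in> ?J \<Longrightarrow> k (x + y) = k x + k y"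
    and scale: "\<And>r x. x \<in> ?J \<Longrightarrow> k (r *\<^sub>R x) = r * k x"
    and L: "L \<ge> 0" and bound: "\<And>x. x \<in> ?J \<Longrightarrow> \<bar>k x\<bar> \<le> L * norm x"
    by (rule bounded_functional_adjoin[OF V False]) blast
  have lip: "dist (k x) (k y) \<le> L * dist x y" if "x \<in> ?J" "y \<in> ?J" for x y
    using add[OF that(1) span_scale[OF that(2), of "-1"]] scale[OF that(2), of "-1"]
      bound[OF span_diff[OF that]] by (simp add: dist_norm)
  show ?thesis
    unfolding closed_sequential_limits
  proof (intro allI impI, elim conjE)
    fix f l assume f: "\<forall>n. f n \<in> ?J" "f \<longlonglongrightarrow> l"
    have "Cauchy (\<lambda>n. k (f n))"
    proof (rule metric_CauchyI)
      \<comment> \<open>The tolerance is \<open>e / (L + 1)\<close> because \<open>L\<close> may be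
        zero.\<close>
      fix e :: real assume "e > 0"
      hence "e / (L + 1) > 0" using L by simp
      then obtain M where M: "\<And>m n. m \<ge> M \<Longrightarrow> n \<ge> M \<Longrightarrow> dist (f m) (f n) < e / (L + 1)"
        using LIMSEQ_imp_Cauchy[OF f(2)] unfolding Cauchy_def by metis
      have "dist (k (f m)) (k (f n)) < e" if "m \<ge> M" "n \<ge> M" for m n
      proof -
        have "dist (k (f m)) (k (f n)) \<le> L * dist (f m) (f n)" using lip f(1) by blast
        also have "\<dots> \<le> L * (e / (L + 1))" using M[OF that] L by (intro mult_left_mono) auto
        also have "\<dots> < e" using L \<open>e > 0\<close> by (simp add: field_simps)
        finally show ?thesis .
      qed
      thus "\<exists>M. \<forall>m\<ge>M. \<forall>n\<ge>M. dist (k (f m)) (k (f n)) < e" by blast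
    qed
    then obtain c where c: "(\<lambda>n. k (f n)) \<longlonglongrightarrow> c"
      using real_Cauchy_convergent convergent_def by blast
    have lim: "(\<lambda>n. f n - k (f n) *\<^sub>R b) \<longlonglongrightarrow> l - c *\<^sub>R b"
      by (intro tendsto_intros f(2) c)
    have "l - c *\<^sub>R b \<in> V"
      using closed_sequentially[OF V(1) _ lim] k f(1) by blast
    thus "l \<in> ?J" unfolding span_breakdown_eq using span_base by blast
  qed
qed

text \<open>Adjoining the elements of \<open>B\<close> one at a time keeps the span closed, so each
  new coefficient is bounded. The coordinates stand in for the quotient by \<open>V\<close>;
  \<open>B\<close> need not be independent modulo \<open>V\<close>, so they are a choice.\<close>

lemma bounded_coordinates:
  fixes V B :: "'a::real_normed_vector set"
  assumes "finite B" and V: "closed V" "subspace V"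
  obtains c K where "closed (span (V \<union> B))" and "K \<ge> 0"
    and "\<And>b x y. b \<in> B \<Longrightarrow> x \<in> span (V \<union> B) \<Longrightarrow> y \<in> span (V \<union> B) \<Longrightarrow> c b (x + y) = c b x + c b y"
    and "\<And>b r x. b \<in> B \<Longrightarrow> x \<in> span (V \<union> B) \<Longrightarrow> c b (r *\<^sub>R x) = r * c b x"
    and "\<And>b x. b \<in> B \<Longrightarrow> x \<in> span (V \<union> B) \<Longrightarrow> \<bar>c b x\<bar> \<le> K * norm x"
    and "\<And>x. x \<in> span (V \<union> B) \<Longrightarrow> x - (\<Sum>b\<in>B. c b x *\<^sub>R b) \<in> V"
  using assms(1)
proof (induction B arbitrary: thesis)
  case empty
  show ?case by (rule empty[of 0 "\<lambda>_ _. 0"]) (use V in \<open>simp_all add: span_eq_iff[THEN iffD2]\<close>)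
next
  case (insert b F)
  let ?W = "span (V \<union> F)" and ?J = "span (V \<union> insert b F)"
  have J: "?J = span (insert b ?W)"
    by (simp add: span_breakdown_eq set_eq_iff span_span)
  obtain c K where W: "closed ?W" and K: "K \<ge> 0"
    and add: "\<And>a x y. a \<in> F \<Longrightarrow> x \<in> ?W \<Longrightarrow> y \<in> ?W \<Longrightarrow> c a (x + y) = c a x + c a y"
    and scale: "\<And>a r x. a \<in> F \<Longrightarrow> x \<in> ?W \<Longrightarrow> c a (r *\<^sub>R x) = r * c a x"
    and bound: "\<And>a x. a \<in> F \<Longrightarrow> x \<in> ?W \<Longrightarrow> \<bar>c a x\<bar> \<le> K * norm x"
    and mem: "\<And>x. x \<in> ?W \<Longrightarrow> x - (\<Sum>a\<in>F. c a x *\<^sub>R a) \<in> V"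
    by (rule insert.IH) blast
  have cl: "closed ?J" unfolding J by (rule closed_span_insert[OF W subspace_span])
  obtain k L where k: "\<And>x. x \<in> ?J \<Longrightarrow> x - k x *\<^sub>R b \<in> ?W"
    and kadd: "\<And>x y. x \<in> ?J \<Longrightarrow> y \<in> ?J \<Longrightarrow> k (x + y) = k x + k y"
    and kscale: "\<And>r x. x \<in> ?J \<Longrightarrow> k (r *\<^sub>R x) = r * k x"
    and L: "L \<ge> 0" and kbound: "\<And>x. x \<in> ?J \<Longrightarrow> \<bar>k x\<bar> \<le> L * norm x"
  proof (cases "b \<in> ?W")
    case True
    \<comment> \<open>A redundant \<open>b\<close> gets the coordinate zero.\<close>
    hence "?J = ?W" unfolding J by (simp add: insert_absorb)
    thus ?thesis using that[of "\<lambda>_. 0" 0] by simp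
  next
    case False
    show ?thesis
      by (rule bounded_functional_adjoin[OF W subspace_span False]) (rule that, unfold J)
  qed
  \<comment> \<open>The old coordinates are read off after the \<open>b\<close>-component is
    removed, which enlarges norms by a factor of at most \<open>1 + L * norm b\<close>. The summand
    \<open>L\<close> in \<open>K'\<close> takes care of the coordinate of \<open>b\<close>
    itself.\<close>
  define c' where "c' a x = (if a = b then k x else c a (x - k x *\<^sub>R b))" for a x
  define K' where "K' = L + K * (1 + L * norm b)"
  have K': "K' \<ge> 0" unfolding K'_def using L K by simp
  have 1: "c' a (x + y) = c' a x + c' a y" if "a \<in> insert b F" "x \<in> ?J" "y \<in> ?J" for a x y
  proof -
    have "x + y - k (x + y) *\<^sub>R b = (x - k x *\<^sub>R b) + (y - k y *\<^sub>R b)"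
      using kadd[OF that(2,3)] by (simp add: algebra_simps)
    hence "c a (x + y - k (x + y) *\<^sub>R b) = c a (x - k x *\<^sub>R b) + c a (y - k y *\<^sub>R b)" if "a \<in> F"
      using add[OF that k k] \<open>x \<in> ?J\<close> \<open>y \<in> ?J\<close> by metis
    thus ?thesis using that(1) kadd[OF that(2,3)] by (auto simp: c'_def)
  qed
  have 2: "c' a (r *\<^sub>R x) = r * c' a x" if "a \<in> insert b F" "x \<in> ?J" for a r x
  proof -
    have "r *\<^sub>R x - k (r *\<^sub>R x) *\<^sub>R b = r *\<^sub>R (x - k x *\<^sub>R b)"
      using kscale[OF that(2)] by (simp add: algebra_simps)
    hence "c a (r *\<^sub>R x - k (r *\<^sub>R x) *\<^sub>R b) = r * c a (x - k x *\<^sub>R b)" if "a \<in> F"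
      using scale[OF that k] \<open>x \<in> ?J\<close> by metis
    thus ?thesis using that(1) kscale[OF that(2)] by (auto simp: c'_def)
  qed
  have 3: "\<bar>c' a x\<bar> \<le> K' * norm x" if "a \<in> insert b F" "x \<in> ?J" for a x
  proof -
    have "norm (x - k x *\<^sub>R b) \<le> norm x + \<bar>k x\<bar> * norm b"
      using norm_triangle_ineq4[of x "k x *\<^sub>R b"] by simp
    also have "\<dots> \<le> norm x + (L * norm x) * norm b"
      by (intro add_left_mono mult_right_mono kbound that norm_ge_zero)
    finally have *: "K * norm (x - k x *\<^sub>R b) \<le> K * (norm x + (L * norm x) * norm b)"
      using K by (rule mult_left_mono)
    have eq: "K' * norm x = L * norm x + K * (norm x + (L * norm x) * norm b)"
      by (simp add: K'_def algebra_simps)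
    have nn: "0 \<le> L * norm x" "0 \<le> K * (norm x + (L * norm x) * norm b)" using L K by auto
    show ?thesis
    proof (cases "a = b")
      case True
      thus ?thesis using kbound[OF that(2)] nn eq by (simp add: c'_def)
    next
      case False
      hence "\<bar>c' a x\<bar> \<le> K * norm (x - k x *\<^sub>R b)"
        using bound[OF _ k[OF that(2)]] that(1) by (simp add: c'_def)
      thus ?thesis using * nn eq by linarith
    qed
  qed
  have 4: "x - (\<Sum>a\<in>insert b F. c' a x *\<^sub>R a) \<in> V" if "x \<in> ?J" for x
  proof -
    have "(\<Sum>a\<in>F. c' a x *\<^sub>R a) = (\<Sum>a\<in>F. c a (x - k x *\<^sub>R b) *\<^sub>R a)"
      using insert.hyps by (intro sum.cong) (auto simp: c'_def)
    hence "x - (\<Sum>a\<in>insert b F. c' a x *\<^sub>R a)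
        = (x - k x *\<^sub>R b) - (\<Sum>a\<in>F. c a (x - k x *\<^sub>R b) *\<^sub>R a)"
      using insert.hyps by (simp add: c'_def diff_diff_eq)
    thus ?thesis using mem[OF k[OF that]] by (simp only:)
  qed
  show ?case by (rule insert.prems[OF cl K' 1 2 3 4])
qed

section \<open>Norm estimates for sums of translations\<close>

lemma Rep_ell2_sum: "Rep_ell2 (sum f W) x = (\<Sum>w\<in>W. Rep_ell2 (f w) x)"
  by (induction W rule: infinite_finite_induct) (simp_all add: zero_ell2.rep_eq plus_ell2.rep_eq)

lemma Rep_ell2_summable: "(\<lambda>x. (cmod (Rep_ell2 f x))\<^sup>2) summable_on UNIV"
  using Rep_ell2[of f] by simp

lemma norm_ell2_mono:
  assumes "C \<ge> 0" and "\<And>x. cmod (Rep_ell2 f x) \<le> C * cmod (Rep_ell2 h x)"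
  shows "norm f \<le> C * norm h"
proof -
  have "(\<Sum>\<^sub>\<infinity>x. (cmod (Rep_ell2 f x))\<^sup>2) \<le> (\<Sum>\<^sub>\<infinity>x. C\<^sup>2 * (cmod (Rep_ell2 h x))\<^sup>2)"
  proof (rule infsum_mono)
    show "(cmod (Rep_ell2 f x))\<^sup>2 \<le> C\<^sup>2 * (cmod (Rep_ell2 h x))\<^sup>2" for x
      using power_mono[OF assms(2) norm_ge_zero, of x 2] by (simp add: power_mult_distrib)
  qed (intro summable_on_cmult_right Rep_ell2_summable)+
  also have "\<dots> = C\<^sup>2 * (\<Sum>\<^sub>\<infinity>x. (cmod (Rep_ell2 h x))\<^sup>2)" by (rule infsum_cmult_right')
  finally have "sqrt (\<Sum>\<^sub>\<infinity>x. (cmod (Rep_ell2 f x))\<^sup>2) \<le> sqrt (C\<^sup>2 * (\<Sum>\<^sub>\<infinity>x. (cmod (Rep_ell2 h x))\<^sup>2))"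
    by (rule real_sqrt_le_mono)
  thus ?thesis using assms(1) by (simp add: norm_ell2 real_sqrt_mult)
qed

lift_definition modulus_ell2 :: "'a ell2 \<Rightarrow> 'a ell2" is "\<lambda>f x. complex_of_real (cmod (f x))"
  by simp

lemma norm_modulus_ell2: "norm (modulus_ell2 f) = norm f"
  by (simp add: norm_ell2 modulus_ell2.rep_eq)

lemma left_reg_add: "left_reg (g + h) = left_reg g o\<^sub>L left_reg h"
  by (rule blinfun_eqI, simp add: left_reg.rep_eq, transfer) (simp only: minus_add add.assoc)

lemma left_reg_0: "left_reg 0 = id_blinfun"
  by (rule blinfun_eqI, simp add: left_reg.rep_eq, transfer) simp

lemma norm_left_reg_le: "norm (left_reg g) \<le> 1"
  by (rule norm_blinfun_bound) (simp_all add: left_reg.rep_eq norm_translate)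

lemma left_reg_in_reduced_cstar: "left_reg g \<in> reduced_cstar"
proof -
  have "left_reg g = left_reg_alg (Poly_Mapping.single g 1)"
    by (simp add: left_reg_alg_def)
  hence "left_reg g \<in> range left_reg_alg" by (rule range_eqI)
  thus ?thesis unfolding reduced_cstar_def by (rule subsetD[OF closure_subset])
qed

text \<open>
  Positivity of the regular representation replaces Fell's absorption principle: the sum on the
  left is dominated pointwise by the sum on the right, applied to the modulus of the vector.
\<close>

lemma norm_weighted_left_reg_sum_le:
  fixes g :: "'i \<Rightarrow> 'g::group_add"
  assumes C: "C \<ge> 0" "\<And>w. w \<in> W \<Longrightarrow> \<bar>c w\<bar> \<le> C"
  shows "norm (\<Sum>w\<in>W. c w *\<^sub>R left_reg (g w)) \<le> C * norm (\<Sum>w\<in>W. left_reg (g w))"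
proof (rule norm_blinfun_bound)
  fix f :: "'g ell2"
  let ?T = "\<Sum>w\<in>W. left_reg (g w)" and ?U = "\<Sum>w\<in>W. c w *\<^sub>R left_reg (g w)"
  have "norm (?U f) \<le> C * norm (?T (modulus_ell2 f))"
  proof (rule norm_ell2_mono[OF C(1)])
    fix x
    have "cmod (Rep_ell2 (?U f) x) = cmod (\<Sum>w\<in>W. of_real (c w) * Rep_ell2 f (- g w + x))"
      by (simp add: blinfun.sum_left blinfun.scaleR_left Rep_ell2_sum scaleR_ell2.rep_eq
          left_reg.rep_eq translate.rep_eq)
    also have "\<dots> \<le> (\<Sum>w\<in>W. C * cmod (Rep_ell2 f (- g w + x)))"
      by (rule order.trans[OF norm_sum]) (auto simp: norm_mult intro!: sum_mono mult_right_mono C(2))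
    also have "\<dots> = C * \<bar>\<Sum>w\<in>W. cmod (Rep_ell2 f (- g w + x))\<bar>"
      by (simp add: sum_distrib_left sum_nonneg)
    also have "\<bar>\<Sum>w\<in>W. cmod (Rep_ell2 f (- g w + x))\<bar> =
        cmod (\<Sum>w\<in>W. complex_of_real (cmod (Rep_ell2 f (- g w + x))))"
      by (metis norm_of_real of_real_sum)
    also have "\<dots> = cmod (Rep_ell2 (?T (modulus_ell2 f)) x)"
      by (simp add: blinfun.sum_left Rep_ell2_sum left_reg.rep_eq translate.rep_eq
          modulus_ell2.rep_eq)
    finally show "cmod (Rep_ell2 (?U f) x) \<le> C * cmod (Rep_ell2 (?T (modulus_ell2 f)) x)" .
  qed
  also have "\<dots> \<le> C * (norm ?T * norm f)"
    using norm_blinfun[of ?T "modulus_ell2 f"] C(1)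
    by (simp add: norm_modulus_ell2 mult_left_mono)
  finally show "norm (?U f) \<le> C * norm ?T * norm f" by (simp add: mult.assoc)
qed (use C in simp)

text \<open>Summing over words, not over the group elements they represent, keeps multiplicities, so
  the sum is the \<open>n\<close>-th power of \<open>\<Sum>s\<in>S. left_reg s\<close>.\<close>

lemma norm_left_reg_words_le:
  fixes S :: "'g::group_add set"
  shows "norm (\<Sum>w | set w \<subseteq> S \<and> length w = n. left_reg (sum_list w))
    \<le> norm (\<Sum>s\<in>S. left_reg s) ^ n"
proof (induction n)
  case 0
  have "{w :: 'g list. set w \<subseteq> S \<and> length w = 0} = {[]}" by auto
  thus ?case using norm_left_reg_le[of "0 :: 'g"] by simp
next
  case (Suc n)
  let ?W = "{w :: 'g list. set w \<subseteq> S \<and> length w = n}"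
  let ?T = "\<Sum>s\<in>S. left_reg s" and ?Tn = "\<Sum>w\<in>?W. left_reg (sum_list w)"
  have "(\<Sum>w | set w \<subseteq> S \<and> length w = Suc n. left_reg (sum_list w))
      = (\<Sum>(w, s)\<in>?W \<times> S. left_reg (s + sum_list w))"
    unfolding lists_length_Suc_eq
    by (subst sum.reindex) (auto simp: inj_on_def intro!: sum.cong)
  also have "\<dots> = (\<Sum>w\<in>?W. \<Sum>s\<in>S. left_reg s o\<^sub>L left_reg (sum_list w))"
    by (simp add: sum.cartesian_product left_reg_add)
  also have "\<dots> = ?T o\<^sub>L ?Tn"
    by (rule blinfun_eqI) (simp add: blinfun.sum_left blinfun.sum_right)
  finally have "norm (\<Sum>w | set w \<subseteq> S \<and> length w = Suc n. left_reg (sum_list w))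
      \<le> norm ?T * norm ?Tn"
    by (simp add: norm_blinfun_compose)
  also have "\<dots> \<le> norm ?T * norm ?T ^ n" by (intro mult_left_mono Suc.IH norm_ge_zero)
  finally show ?case by simp
qed

section \<open>Real scalars, and ideals close to the identity\<close>

lemma op_scale_of_real: "complex_of_real r *\<^sub>O T = r *\<^sub>R T"
  unfolding op_scale_def
  by (rule blinfun_eqI, simp add: blinfun.scaleR_left cmult.rep_eq, transfer) simp

lemma subspace_of_op_subspace:
  assumes "op_subspace V"
  shows "subspace V"
proof (rule subspaceI)
  show "r *\<^sub>R x \<in> V" if "x \<in> V" for r x
    using op.subspace_scale[OF assms that, of "complex_of_real r"] by (simp add: op_scale_of_real)
qed (use assms op.subspace_0 op.subspace_add in blast)+

text \<open>Splitting each complex coefficient into real and imaginary part doubles the spanning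
  set. A complex finite-dimensional quotient thus becomes accessible to real coordinates.\<close>

lemma op_span_subset_span: "op_span B \<subseteq> span (B \<union> (*\<^sub>O) \<i> ` B)"
proof
  let ?V = "span (B \<union> (*\<^sub>O) \<i> ` B)"
  fix x assume "x \<in> op_span B"
  thus "x \<in> ?V"
  proof (induction x rule: op.span_induct_alt)
    case (step c b y)
    have "c *\<^sub>O b = Re c *\<^sub>R b + Im c *\<^sub>R (\<i> *\<^sub>O b)"
      by (simp flip: op_scale_of_real op.scale_left_distrib add: complex_eq mult.commute)
    moreover have "\<dots> \<in> ?V"
      using step.hyps by (intro span_add span_scale span_base) auto
    ultimately show ?case using step.IH by (simp add: span_add)
  qed (rule span_zero)
qed

text \<open>
  If \<open>i \<in> I\<close> has distance less than 1 from the identity, then the powers of \<open>z = 1 - i\<close> are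
  congruent to 1 modulo \<open>I\<close> and tend to 0.
\<close>

lemma closed_ideal_eq_of_near_id:
  assumes I: "closed_ideal A I" and i: "i \<in> I" and one: "norm (id_blinfun - i) < 1"
  shows "I = A"
proof -
  have sub: "subspace I" and IA: "I \<subseteq> A" and cl: "closed I"
    and l: "\<And>a x. a \<in> A \<Longrightarrow> x \<in> I \<Longrightarrow> a o\<^sub>L x \<in> I"
    using I subspace_of_op_subspace by (auto simp: closed_ideal_def)
  define z where "z = id_blinfun - i"
  define p where "p n = (((o\<^sub>L) z) ^^ n) id_blinfun" for n
  have pS: "p (Suc n) = z o\<^sub>L p n" for n by (simp add: p_def)
  have pI: "id_blinfun - p n \<in> I" for n
  proof (induction n)
    case 0
    show ?case using subspace_0[OF sub] by (simp add: p_def)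
  next
    case (Suc n)
    \<comment> \<open>Expanding \<open>z\<close> gives
      \<open>p (Suc n) = p n - (i o\<^sub>L p n)\<close>. In this form only multiplication by
      \<open>i\<close>, which lies in \<open>A\<close>, is applied to elements of
      \<open>I\<close>.\<close>
    have "i - (i o\<^sub>L (id_blinfun - p n)) + (id_blinfun - p n) \<in> I"
      by (intro subspace_add[OF sub _ Suc] subspace_diff[OF sub i] l Suc subsetD[OF IA i])
    also have "i - (i o\<^sub>L (id_blinfun - p n)) + (id_blinfun - p n) = id_blinfun - p (Suc n)"
      unfolding pS z_def
      by (rule blinfun_eqI) (simp add: blinfun.diff_left blinfun.diff_right blinfun.add_left)
    finally show ?case .
  qed
  have "norm (p n) \<le> norm z ^ n * norm (p 0)" for n
  proof (induction n)
    case (Suc n)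
    have "norm (p (Suc n)) \<le> norm z * norm (p n)" unfolding pS by (rule norm_blinfun_compose)
    also have "\<dots> \<le> norm z * (norm z ^ n * norm (p 0))"
      by (intro mult_left_mono Suc norm_ge_zero)
    finally show ?case by simp
  qed simp
  moreover have "(\<lambda>n. norm z ^ n * norm (p 0)) \<longlonglongrightarrow> 0"
    using one by (intro tendsto_mult_left_zero LIMSEQ_realpow_zero) (auto simp: z_def)
  ultimately have "p \<longlonglongrightarrow> 0"
    using Lim_null_comparison[of p "\<lambda>n. norm z ^ n * norm (p 0)"] by simp
  hence "(\<lambda>n. id_blinfun - p n) \<longlonglongrightarrow> id_blinfun - 0" by (intro tendsto_intros)
  hence "id_blinfun \<in> I" using closed_sequentially[OF cl, of "\<lambda>n. id_blinfun - p n"] pI by simp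
  moreover have "a o\<^sub>L id_blinfun = a" for a :: "'a op" by (rule blinfun_eqI) simp
  ultimately show ?thesis using IA l by (metis subsetI subset_antisym)
qed

section \<open>Kesten's norm condition from a proper ideal of finite codimension\<close>

text \<open>The triangle inequality gives the opposite bound, so this is the extremal norm in
  Kesten's criterion for amenability. A smaller norm would make the weighted sums over words of
  length \<open>n\<close> grow more slowly than \<open>card S ^ n\<close>, although their
  coordinates are too large for that.\<close>

lemma norm_left_reg_sum_ge:
  fixes I :: "'g::group_add op set" and S :: "'g set"
  assumes I: "closed_ideal reduced_cstar I" "I \<noteq> reduced_cstar"
    and fin: "finite_dim_quotient reduced_cstar I" and S: "finite S"
  shows "real (card S) \<le> norm (\<Sum>s\<in>S. left_reg s)"
proof (rule ccontr)
  assume neg: "\<not> ?thesis"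
  define \<rho> where "\<rho> = norm (\<Sum>s\<in>S. left_reg s)"
  have less: "\<rho> < real (card S)" and \<rho>: "\<rho> \<ge> 0"
    using neg by (simp_all add: \<rho>_def)
  let ?A = "reduced_cstar :: 'g op set"
  have sub: "subspace I" and IA: "I \<subseteq> ?A" and cl: "closed I"
    and l: "\<And>a x. a \<in> ?A \<Longrightarrow> x \<in> I \<Longrightarrow> a o\<^sub>L x \<in> I"
    using I subspace_of_op_subspace by (auto simp: closed_ideal_def)
  obtain B0 where B0: "finite B0" "quotient_space ?A I = (\<lambda>s. s +o I) ` op_span B0"
    using fin by (auto simp: finite_dim_quotient_def)
  define B where "B = B0 \<union> (*\<^sub>O) \<i> ` B0"
  have B: "finite B" using B0 by (simp add: B_def)
  have AJ: "?A \<subseteq> span (I \<union> B)"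
  proof
    fix a assume "a \<in> ?A"
    hence "a +o I \<in> (\<lambda>s. s +o I) ` op_span B0"
      using B0(2) by (auto simp: quotient_space_def)
    then obtain s where s: "s \<in> op_span B0" "a +o I = s +o I" by auto
    have "a + 0 \<in> a +o I" using subspace_0[OF sub] by (rule set_plus_intro2)
    hence "a \<in> s +o I" using s(2) by simp
    then obtain i where i: "i \<in> I" "a = s + i" by (auto simp: elt_set_plus_def)
    have "s \<in> span B" using op_span_subset_span s(1) by (auto simp: B_def)
    thus "a \<in> span (I \<union> B)"
      unfolding i(2) using i(1) span_mono[of B "I \<union> B"] span_base[of i "I \<union> B"]
      by (intro span_add) auto
  qed
  obtain c K where K: "K \<ge> 0"
    and add: "\<And>b x y. b \<in> B \<Longrightarrow> x \<in> span (I \<union> B) \<Longrightarrow> y \<in> span (I \<union> B) \<Longrightarrow> c b (x + y) = c b x + c b y"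
    and scale: "\<And>b r x. b \<in> B \<Longrightarrow> x \<in> span (I \<union> B) \<Longrightarrow> c b (r *\<^sub>R x) = r * c b x"
    and bound: "\<And>b x. b \<in> B \<Longrightarrow> x \<in> span (I \<union> B) \<Longrightarrow> \<bar>c b x\<bar> \<le> K * norm x"
    and mem: "\<And>x. x \<in> span (I \<union> B) \<Longrightarrow> x - (\<Sum>b\<in>B. c b x *\<^sub>R b) \<in> I"
    by (rule bounded_coordinates[OF B cl sub]) blast
  have lam: "left_reg g \<in> span (I \<union> B)" for g using AJ left_reg_in_reduced_cstar by blast
  have lam_le: "\<bar>c b (left_reg g)\<bar> \<le> K" if "b \<in> B" for b g
    using bound[OF that lam] norm_left_reg_le[of g] K
    by (meson mult_left_le order.trans)
  have csum: "c b (\<Sum>w\<in>W. r w *\<^sub>R left_reg (h w)) = (\<Sum>w\<in>W. r w * c b (left_reg (h w)))"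
    if "b \<in> B" for b W r and h :: "'g list \<Rightarrow> 'g"
  proof -
    have 0: "c b 0 = 0" using scale[OF that span_zero, of 0] by simp
    have mem_span: "(\<Sum>w\<in>W. r w *\<^sub>R left_reg (h w)) \<in> span (I \<union> B)" for W
      by (intro span_sum span_scale lam)
    show ?thesis
      by (induction W rule: infinite_finite_induct)
        (simp_all add: 0 add[OF that span_scale[OF lam] mem_span] scale[OF that lam])
  qed
  define M where "M = (\<Sum>b\<in>B. norm b ^ 2)"
  \<comment> \<open>Otherwise, by Cauchy-Schwarz, \<open>left_reg g\<close> is congruent modulo
    \<open>I\<close> to some \<open>?y\<close> of norm below 1. Multiplying by
    \<open>left_reg (- g)\<close> moves this to the identity and forces \<open>I\<close> to be the
    whole algebra.\<close>
  have low: "1 \<le> M * (\<Sum>b\<in>B. c b (left_reg g) ^ 2)" for g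
  proof (rule ccontr)
    assume neg': "\<not> ?thesis"
    let ?y = "\<Sum>b\<in>B. c b (left_reg g) *\<^sub>R b"
    have "norm ?y \<le> (\<Sum>b\<in>B. \<bar>c b (left_reg g)\<bar> * norm b)"
      by (rule order.trans[OF norm_sum]) simp
    hence "norm ?y ^ 2 \<le> (\<Sum>b\<in>B. \<bar>c b (left_reg g)\<bar> * norm b) ^ 2"
      by (intro power_mono norm_ge_zero)
    also have "\<dots> \<le> (\<Sum>b\<in>B. \<bar>c b (left_reg g)\<bar> ^ 2) * (\<Sum>b\<in>B. norm b ^ 2)"
      by (rule Cauchy_Schwarz_ineq_sum)
    also have "\<dots> < 1" using neg' by (simp add: M_def mult.commute)
    finally have y: "norm ?y < 1" by (simp add: power_less_one_iff abs_square_less_1)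
    have "left_reg (- g) o\<^sub>L (left_reg g - ?y) \<in> I"
      by (intro l left_reg_in_reduced_cstar mem lam)
    moreover have "left_reg (- g) o\<^sub>L (left_reg g - ?y) = id_blinfun - (left_reg (- g) o\<^sub>L ?y)"
      using left_reg_add[of "- g" g]
      by (simp add: left_reg_0 bounded_bilinear.diff_right[OF bounded_bilinear_blinfun_compose])
    moreover have "norm (left_reg (- g) o\<^sub>L ?y) < 1"
      using norm_blinfun_compose[of "left_reg (- g)" ?y] norm_left_reg_le[of "- g"] y
      by (smt (verit) mult_left_le_one_le norm_ge_zero)
    ultimately have "I = ?A"
      by (intro closed_ideal_eq_of_near_id[OF I(1), of "id_blinfun - (left_reg (- g) o\<^sub>L ?y)"]) simp_all
    thus False using I(2) by contradiction
  qed
  \<comment> \<open>One factor \<open>K\<close> bounds the weights, the other is the bound of the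
    functional \<open>c b\<close>.\<close>
  have up: "(\<Sum>w | set w \<subseteq> S \<and> length w = n. c b (left_reg (sum_list w)) ^ 2) \<le> K * (K * \<rho> ^ n)"
    if "b \<in> B" for b n
  proof -
    let ?W = "{w. set w \<subseteq> S \<and> length w = n}"
    let ?a = "\<Sum>w\<in>?W. c b (left_reg (sum_list w)) *\<^sub>R left_reg (sum_list w)"
    have "norm ?a \<le> K * norm (\<Sum>w\<in>?W. left_reg (sum_list w))"
      by (intro norm_weighted_left_reg_sum_le K lam_le that)
    also have "\<dots> \<le> K * \<rho> ^ n"
      unfolding \<rho>_def by (intro mult_left_mono norm_left_reg_words_le K)
    finally have a: "norm ?a \<le> K * \<rho> ^ n" .
    have "(\<Sum>w\<in>?W. c b (left_reg (sum_list w)) ^ 2) = c b ?a"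
      by (simp add: csum[OF that] power2_eq_square)
    also have "\<dots> \<le> K * norm ?a"
      using bound[OF that, of ?a] lam by (force intro: span_sum span_scale)
    also have "\<dots> \<le> K * (K * \<rho> ^ n)" by (intro mult_left_mono a K)
    finally show ?thesis .
  qed
  have M: "M \<ge> 0" unfolding M_def by (intro sum_nonneg) simp
  define D where "D = M * (card B * (K * K))"
  have key: "real (card S) ^ n \<le> D * \<rho> ^ n" for n
  proof -
    let ?W = "{w. set w \<subseteq> S \<and> length w = n}"
    have "real (card S) ^ n = (\<Sum>w\<in>?W. 1)" by (simp add: card_lists_length_eq[OF S])
    also have "\<dots> \<le> (\<Sum>w\<in>?W. M * (\<Sum>b\<in>B. c b (left_reg (sum_list w)) ^ 2))"
      by (intro sum_mono low)
    also have "\<dots> = M * (\<Sum>b\<in>B. \<Sum>w\<in>?W. c b (left_reg (sum_list w)) ^ 2)"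
      by (subst sum.swap) (simp add: sum_distrib_left)
    also have "\<dots> \<le> M * (\<Sum>b\<in>B. K * (K * \<rho> ^ n))" by (intro mult_left_mono sum_mono up M)
    also have "\<dots> = D * \<rho> ^ n" by (simp add: D_def)
    finally show ?thesis .
  qed
  have pos: "real (card S) > 0" using less \<rho> by linarith
  \<comment> \<open>\<open>D\<close> does not depend on \<open>n\<close>, so the ratio below 1
    wins.\<close>
  have "(\<lambda>n. D * (\<rho> / card S) ^ n) \<longlonglongrightarrow> 0"
    using less \<rho> pos by (intro tendsto_mult_right_zero LIMSEQ_realpow_zero) simp_all
  moreover have "1 \<le> D * (\<rho> / card S) ^ n" for n
    using key[of n] pos by (simp add: power_divide field_simps)
  ultimately have "(1::real) \<le> 0" by (intro LIMSEQ_le_const) auto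
  thus False by simp
qed

section \<open>Almost invariant unit vectors\<close>

text \<open>
  Uniform convexity: if the average of the unit vectors \<open>left_reg s f\<close>, \<open>s \<in> S\<close>, has norm almost
  1, then these vectors are close to each other.
\<close>

lemma almost_invariant_vector:
  fixes S :: "'g::group_add set"
  assumes S: "finite S" and ge: "\<And>T :: 'g set. finite T \<Longrightarrow> real (card T) \<le> norm (\<Sum>s\<in>T. left_reg s)"
    and "\<delta> > 0"
  obtains f :: "'g ell2" where "norm f = 1" and "\<And>s. s \<in> S \<Longrightarrow> norm (translate s f - f) \<le> \<delta>"
proof -
  \<comment> \<open>The neutral element makes \<open>f\<close> itself one of the averaged vectors,
    so that each translate can be compared with it.\<close>
  let ?S = "insert 0 S" and ?T = "\<Sum>s\<in>insert 0 S. left_reg s"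
  \<comment> \<open>The final estimate is \<open>4 * \<epsilon> - \<epsilon>\<^sup>2\<close>, hence
    the quarter of \<open>\<delta>\<^sup>2\<close>. The cap 1 keeps \<open>2 - \<epsilon>\<close>
    and \<open>card ?S - \<epsilon>\<close> nonnegative.\<close>
  define \<epsilon> where "\<epsilon> = min 1 (\<delta>\<^sup>2 / 4)"
  have \<epsilon>: "\<epsilon> > 0" "\<epsilon> \<le> 1" "4 * \<epsilon> \<le> \<delta>\<^sup>2" using \<open>\<delta> > 0\<close> by (auto simp: \<epsilon>_def)
  have n: "real (card ?S) \<ge> 1" using S card_gt_0_iff[of ?S] by (simp add: Suc_le_eq)
  have "\<exists>h :: 'g ell2. (real (card ?S) - \<epsilon>) * norm h < norm (?T h)"
  proof (rule ccontr)
    assume "\<nexists>h :: 'g ell2. (real (card ?S) - \<epsilon>) * norm h < norm (?T h)"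
    hence "norm ?T \<le> real (card ?S) - \<epsilon>"
      using n \<epsilon> by (intro norm_blinfun_bound) (auto simp: not_less)
    thus False using ge[of ?S] S \<epsilon> by simp
  qed
  then obtain h :: "'g ell2" where h: "(real (card ?S) - \<epsilon>) * norm h < norm (?T h)" by blast
  hence h0: "norm h > 0" by auto
  define f where "f = (1 / norm h) *\<^sub>R h"
  have f1: "norm f = 1" using h0 by (simp add: f_def)
  have "norm (?T f) = norm (?T h) / norm h" by (simp add: f_def blinfun.scaleR_right)
  hence "real (card ?S) - \<epsilon> < norm (?T f)"
    using h h0 by (simp only: pos_less_divide_eq)
  hence Tf: "real (card ?S) - \<epsilon> < norm (\<Sum>s\<in>?S. translate s f)"
    by (simp only: blinfun.sum_left left_reg.rep_eq)
  have "norm (translate s f - f) \<le> \<delta>" if "s \<in> S" for s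
  proof (cases "s = 0")
    case True
    have "translate 0 f = f" by transfer simp
    thus ?thesis using True \<open>\<delta> > 0\<close> by simp
  next
    case False
    have [simp]: "translate 0 f = f" by transfer simp
    \<comment> \<open>The other \<open>card ?S - 2\<close> unit vectors contribute at most their
      number, so these two alone must have a sum of norm at least
      \<open>2 - \<epsilon>\<close>.\<close>
    have "(\<Sum>t\<in>?S. translate t f) = (translate s f + f) + (\<Sum>t\<in>?S - {0, s}. translate t f)"
      using S that False by (subst sum.subset_diff[of "{0, s}"]) (auto simp: algebra_simps)
    hence "norm (\<Sum>t\<in>?S. translate t f) \<le> norm (translate s f + f) + norm (\<Sum>t\<in>?S - {0, s}. translate t f)"
      using norm_triangle_ineq by metis
    also have "norm (\<Sum>t\<in>?S - {0, s}. translate t f) \<le> (\<Sum>t\<in>?S - {0, s}. 1)"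
      by (rule sum_norm_le) (simp add: norm_translate f1)
    also have "(\<Sum>t\<in>?S - {0, s}. 1) = real (card ?S) - 2"
    proof -
      have "card ?S = card (?S - {0, s}) + card {0, s}"
        using S that by (metis card_Diff_subset card_mono finite.emptyI finite_insert insert_subset
            le_add_diff_inverse2 subset_insertI insertCI empty_subsetI)
      thus ?thesis using False by simp
    qed
    finally have "2 - \<epsilon> \<le> norm (translate s f + f)" using Tf by linarith
    hence "(2 - \<epsilon>)\<^sup>2 \<le> (norm (translate s f + f))\<^sup>2" using \<epsilon> by (intro power_mono) auto
    \<comment> \<open>The parallelogram law for two unit vectors.\<close>
    moreover have "(norm (translate s f - f))\<^sup>2 + (norm (translate s f + f))\<^sup>2 = 4"
      using norm_translate[of s f] f1
      by (simp add: power2_norm_eq_inner inner_simps inner_commute norm_eq_1)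
    ultimately have "(norm (translate s f - f))\<^sup>2 \<le> 4 * \<epsilon> - \<epsilon>\<^sup>2"
      by (simp add: power2_diff algebra_simps)
    also have "\<dots> \<le> \<delta>\<^sup>2" using \<epsilon>(3) zero_le_power2[of \<epsilon>] by linarith
    finally show ?thesis using \<open>\<delta> > 0\<close> by (simp add: power2_le_iff_abs_le)
  qed
  thus ?thesis using that f1 by blast
qed

section \<open>Means given by unit vectors\<close>

lemma weighted_summable:
  fixes f :: "'a ell2"
  assumes "\<phi> \<in> ell_infinity"
  shows "(\<lambda>x. \<phi> x * (cmod (Rep_ell2 f x))\<^sup>2) summable_on UNIV"
proof -
  obtain F where F: "\<And>x. \<bar>\<phi> x\<bar> \<le> F"
    using assms by (auto simp: ell_infinity_def bounded_iff)
  have "(\<lambda>x. norm (\<phi> x * (cmod (Rep_ell2 f x))\<^sup>2)) summable_on UNIV"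
  proof (rule summable_on_comparison_test)
    show "(\<lambda>x. F * (cmod (Rep_ell2 f x))\<^sup>2) summable_on UNIV"
      by (intro summable_on_cmult_right Rep_ell2_summable)
  qed (auto simp: abs_mult intro!: mult_right_mono F)
  thus ?thesis by (rule abs_summable_summable)
qed

lemma infsum_cmod_sq: "(\<Sum>\<^sub>\<infinity>x. (cmod (Rep_ell2 f x))\<^sup>2) = (norm f)\<^sup>2"
  by (simp add: norm_ell2 infsum_nonneg)

text \<open>The difference of squared moduli is estimated pointwise by a weighted
  arithmetic-geometric mean inequality, with the weight chosen so that summation gives
  \<open>F * (\<delta> / 2 + 2 * \<delta>)\<close>.\<close>

lemma weighted_diff_le:
  fixes u v :: "'a ell2"
  assumes \<phi>: "\<phi> \<in> ell_infinity" "\<And>x. \<bar>\<phi> x\<bar> \<le> F" and "norm u = 1" "norm v = 1"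
    and \<delta>: "norm (u - v) \<le> \<delta>" "\<delta> > 0"
  shows "\<bar>(\<Sum>\<^sub>\<infinity>x. \<phi> x * (cmod (Rep_ell2 u x))\<^sup>2) - (\<Sum>\<^sub>\<infinity>x. \<phi> x * (cmod (Rep_ell2 v x))\<^sup>2)\<bar> \<le> 3 * \<delta> * F"
proof -
  have F: "F \<ge> 0" using \<phi>(2)[of undefined] by linarith
  let ?u = "\<lambda>x. cmod (Rep_ell2 u x)" and ?v = "\<lambda>x. cmod (Rep_ell2 v x)"
    and ?d = "\<lambda>x. cmod (Rep_ell2 (u - v) x)"
  let ?M = "\<lambda>x. F * (1 / (2 * \<delta>) * (?d x)\<^sup>2 + \<delta> * ((?u x)\<^sup>2 + (?v x)\<^sup>2))"
  have su: "(\<lambda>x. \<phi> x * (?u x)\<^sup>2) summable_on UNIV" and sv: "(\<lambda>x. \<phi> x * (?v x)\<^sup>2) summable_on UNIV"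
    using weighted_summable \<phi>(1) by blast+
  have sdiff: "(\<lambda>x. \<phi> x * (?u x)\<^sup>2 - \<phi> x * (?v x)\<^sup>2) summable_on UNIV"
    using summable_on_add[OF su summable_on_uminus[THEN iffD2, OF sv]] by simp
  have sM: "?M summable_on UNIV"
    by (intro summable_on_cmult_right summable_on_add Rep_ell2_summable)
  have le: "norm (\<phi> x * (?u x)\<^sup>2 - \<phi> x * (?v x)\<^sup>2) \<le> ?M x" for x
  proof -
    have d: "\<bar>?u x - ?v x\<bar> \<le> ?d x" by (simp add: minus_ell2.rep_eq norm_triangle_ineq3)
    have "\<bar>(?u x)\<^sup>2 - (?v x)\<^sup>2\<bar> = \<bar>?u x - ?v x\<bar> * (?u x + ?v x)"
      by (simp add: power2_eq_square square_diff_square_factored abs_mult mult.commute)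
    also have "\<dots> \<le> ?d x * (?u x + ?v x)" by (intro mult_right_mono d) auto
    \<comment> \<open>Young's inequality: \<open>?d x\<close> is small in norm, so its square can
      afford the factor \<open>1 / (2 * \<delta>)\<close>.\<close>
    also have "\<dots> \<le> 1 / (2 * \<delta>) * (?d x)\<^sup>2 + \<delta> / 2 * (?u x + ?v x)\<^sup>2"
      using zero_le_power2[of "?d x - \<delta> * (?u x + ?v x)"] \<delta>(2)
      by (simp add: power2_eq_square field_simps)
    also have "(?u x + ?v x)\<^sup>2 \<le> 2 * ((?u x)\<^sup>2 + (?v x)\<^sup>2)"
      using sum_squares_bound[of "?u x" "?v x"] by (simp add: power2_sum)
    finally have "\<bar>(?u x)\<^sup>2 - (?v x)\<^sup>2\<bar> \<le> 1 / (2 * \<delta>) * (?d x)\<^sup>2 + \<delta> * ((?u x)\<^sup>2 + (?v x)\<^sup>2)"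
      using \<delta>(2) by (simp add: distrib_left)
    hence "\<bar>\<phi> x\<bar> * \<bar>(?u x)\<^sup>2 - (?v x)\<^sup>2\<bar> \<le> ?M x" using \<phi>(2) F by (intro mult_mono) auto
    thus ?thesis by (simp flip: right_diff_distrib add: abs_mult)
  qed
  have "\<bar>(\<Sum>\<^sub>\<infinity>x. \<phi> x * (?u x)\<^sup>2) - (\<Sum>\<^sub>\<infinity>x. \<phi> x * (?v x)\<^sup>2)\<bar>
      = norm (\<Sum>\<^sub>\<infinity>x. \<phi> x * (?u x)\<^sup>2 - \<phi> x * (?v x)\<^sup>2)"
    using infsum_add[OF su summable_on_uminus[THEN iffD2, OF sv]] by (simp add: infsum_uminus)
  also have "\<dots> \<le> (\<Sum>\<^sub>\<infinity>x. ?M x)"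
    by (intro norm_infsum_le[OF has_sum_infsum[OF sdiff] has_sum_infsum[OF sM] le])
  also have "\<dots> = F * (1 / (2 * \<delta>) * (norm (u - v))\<^sup>2 + \<delta> * ((norm u)\<^sup>2 + (norm v)\<^sup>2))"
    by (simp only: infsum_cmult_right' infsum_add summable_on_cmult_right summable_on_add
        Rep_ell2_summable infsum_cmod_sq)
  also have "\<dots> \<le> F * (1 / (2 * \<delta>) * \<delta>\<^sup>2 + \<delta> * (1 + 1))"
    using assms F by (intro mult_left_mono add_mono mult_mono power_mono) auto
  also have "\<dots> \<le> 3 * \<delta> * F" using \<delta>(2) F by (simp add: power2_eq_square field_simps)
  finally show ?thesis .
qed

text \<open>Integration against the density
  \<open>\<lambda>x. (cmod (Rep_ell2 f x))\<^sup>2\<close>, a probability density when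
  \<open>f\<close> is a unit vector. The value 0 on unbounded functions keeps those coordinates
  bounded as well, for use in a compact product.\<close>

definition vector_mean :: "'a ell2 \<Rightarrow> ('a \<Rightarrow> real) \<Rightarrow> real" where
  "vector_mean f \<phi> = (if \<phi> \<in> ell_infinity then \<Sum>\<^sub>\<infinity>x. \<phi> x * (cmod (Rep_ell2 f x))\<^sup>2 else 0)"

lemma ell_infinity_add: "\<phi> \<in> ell_infinity \<Longrightarrow> \<psi> \<in> ell_infinity \<Longrightarrow> (\<lambda>x. \<phi> x + \<psi> x) \<in> ell_infinity"
  unfolding ell_infinity_def mem_Collect_eq by (rule bounded_plus_comp)

lemma ell_infinity_cmult: "\<phi> \<in> ell_infinity \<Longrightarrow> (\<lambda>x. c * \<phi> x) \<in> ell_infinity"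
  using bounded_scaling[of "range \<phi>" c] by (simp add: ell_infinity_def image_image)

lemma ell_infinity_const: "(\<lambda>_. c) \<in> ell_infinity"
  by (simp add: ell_infinity_def)

lemma ell_infinity_translate:
  fixes \<phi> :: "'g::group_add \<Rightarrow> real"
  assumes "\<phi> \<in> ell_infinity" shows "(\<lambda>x. \<phi> (- g + x)) \<in> ell_infinity"
  using assms unfolding ell_infinity_def mem_Collect_eq by (rule bounded_subset) auto

text \<open>The substitution of \<open>g + x\<close> for \<open>x\<close> moves the translation from
  the function to the vector, with the sign of \<open>g\<close> reversed.\<close>

lemma vector_mean_translate:
  fixes f :: "'g::group_add ell2"
  assumes "\<phi> \<in> ell_infinity"
  shows "vector_mean f (\<lambda>x. \<phi> (- g + x)) = vector_mean (translate (- g) f) \<phi>"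
proof -
  have "(\<Sum>\<^sub>\<infinity>x. \<phi> (- g + (g + x)) * (cmod (Rep_ell2 f (g + x)))\<^sup>2)
      = (\<Sum>\<^sub>\<infinity>x. \<phi> (- g + x) * (cmod (Rep_ell2 f x))\<^sup>2)"
    by (rule infsum_reindex_bij_betw) (simp add: bij_plus_right)
  moreover have "- g + (g + x) = x" for x :: 'g by (simp flip: add.assoc)
  ultimately show ?thesis
    using ell_infinity_translate[OF assms, of g] assms
    by (simp add: vector_mean_def translate.rep_eq)
qed

lemma vector_mean_bound:
  assumes "norm f = 1" "\<phi> \<in> ell_infinity" and "\<And>x. \<bar>\<phi> x\<bar> \<le> F"
  shows "\<bar>vector_mean f \<phi>\<bar> \<le> F"
proof -
  have "norm (\<Sum>\<^sub>\<infinity>x. \<phi> x * (cmod (Rep_ell2 f x))\<^sup>2) \<le> (\<Sum>\<^sub>\<infinity>x. F * (cmod (Rep_ell2 f x))\<^sup>2)"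
    by (rule norm_infsum_le)
      (auto simp: abs_mult intro!: has_sum_infsum weighted_summable assms summable_on_cmult_right
        Rep_ell2_summable mult_right_mono)
  thus ?thesis using assms(1,2) by (simp add: vector_mean_def infsum_cmult_right' infsum_cmod_sq)
qed

text \<open>Tychonoff's theorem: the means of the almost invariant vectors have a cluster point.\<close>

lemma amenable_of_almost_invariant_vectors:
  assumes ex: "\<And>(S :: 'g::group_add set) \<delta>. finite S \<Longrightarrow> \<delta> > 0 \<Longrightarrow>
    \<exists>f :: 'g ell2. norm f = 1 \<and> (\<forall>s\<in>S. norm (translate s f - f) \<le> \<delta>)"
  shows "amenable TYPE('g)"
proof -
  have "\<exists>F\<ge>0. \<phi> \<in> ell_infinity \<longrightarrow> (\<forall>x. \<bar>\<phi> x\<bar> \<le> F)" for \<phi> :: "'g \<Rightarrow> real"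
  proof (cases "\<phi> \<in> ell_infinity")
    case True
    then obtain F where "F > 0" "\<forall>x. \<bar>\<phi> x\<bar> \<le> F"
      by (auto simp: ell_infinity_def bounded_pos)
    thus ?thesis by (intro exI[of _ F]) simp
  qed auto
  then obtain F where F0: "\<And>\<phi> :: 'g \<Rightarrow> real. F \<phi> \<ge> 0"
    and F: "\<And>(\<phi> :: 'g \<Rightarrow> real) x. \<phi> \<in> ell_infinity \<Longrightarrow> \<bar>\<phi> x\<bar> \<le> F \<phi>"
    by metis
  \<comment> \<open>Each condition involves finitely many values of \<open>m\<close>, hence is
    closed under pointwise convergence.\<close>
  define means :: "(('g \<Rightarrow> real) \<Rightarrow> real) set" where "means = {m.
     (\<forall>\<phi>\<in>ell_infinity. \<forall>\<psi>\<in>ell_infinity. m (\<lambda>x. \<phi> x + \<psi> x) = m \<phi> + m \<psi>) \<and>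
     (\<forall>c. \<forall>\<phi>\<in>ell_infinity. m (\<lambda>x. c * \<phi> x) = c * m \<phi>) \<and>
     (\<forall>\<phi>\<in>ell_infinity. (\<forall>x. 0 \<le> \<phi> x) \<longrightarrow> 0 \<le> m \<phi>) \<and>
     m (\<lambda>_. 1) = 1}"
  \<comment> \<open>Scaling the error by \<open>F \<phi>\<close> lets one \<epsilon> serve all
    bounded functions at once.\<close>
  define almost where "almost = (\<lambda>(g :: 'g, \<epsilon>).
    {m \<in> means. \<forall>\<phi>\<in>ell_infinity. \<bar>m (\<lambda>x. \<phi> (- g + x)) - m \<phi>\<bar> \<le> \<epsilon> * F \<phi>})"
  define box where "box = PiE UNIV (\<lambda>\<phi> :: 'g \<Rightarrow> real. {- F \<phi> .. F \<phi>})"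
  have coord: "continuous_on UNIV (\<lambda>m :: ('g \<Rightarrow> real) \<Rightarrow> real. m \<phi>)" for \<phi> by simp
  have "compactin (product_topology (\<lambda>_. euclidean) UNIV) box"
    unfolding box_def compactin_PiE by simp
  hence "compact box" unfolding euclidean_product_topology by simp
  hence "box \<inter> (\<Inter>p\<in>UNIV \<times> {0<..}. almost p) \<noteq> {}"
  proof (rule compact_imp_fip_image)
    fix p
    have "closed means"
      unfolding means_def Ball_def
      by (intro closed_Collect_conj closed_Collect_all closed_Collect_imp open_Collect_const
          closed_Collect_eq closed_Collect_le continuous_intros coord)
    thus "closed (almost p)"
      unfolding almost_def case_prod_beta Collect_conj_eq Collect_mem_eq Ball_def
      by (intro closed_Int closed_Collect_all closed_Collect_imp open_Collect_const
          closed_Collect_le continuous_intros coord)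
  next
    fix P assume P: "finite P" "P \<subseteq> (UNIV :: 'g set) \<times> {0::real<..}"
    \<comment> \<open>The third cancels the factor 3 of \<open>weighted_diff_le\<close>; the
      inserted 1 covers empty \<open>P\<close>.\<close>
    define \<delta> :: real where "\<delta> = Min (insert 1 (snd ` P)) / 3"
    have \<delta>: "\<delta> > 0" using P by (auto simp: \<delta>_def)
    have \<delta>P: "3 * \<delta> \<le> \<epsilon>" if "(g, \<epsilon>) \<in> P" for g \<epsilon>
      using P that unfolding \<delta>_def by (force intro: Min_le)
    obtain f :: "'g ell2" where f: "norm f = 1" "\<And>s. s \<in> (\<lambda>p. - fst p) ` P \<Longrightarrow> norm (translate s f - f) \<le> \<delta>"
      using ex[of "(\<lambda>p. - fst p) ` P" \<delta>] P \<delta> by auto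
    have "vector_mean f \<in> means"
      unfolding means_def
      using f(1) by (auto simp: vector_mean_def ell_infinity_add ell_infinity_cmult ell_infinity_const
          distrib_right infsum_add weighted_summable mult.assoc infsum_cmult_right' infsum_cmod_sq
          intro!: infsum_nonneg)
    moreover have "\<bar>vector_mean f (\<lambda>x. \<phi> (- g + x)) - vector_mean f \<phi>\<bar> \<le> \<epsilon> * F \<phi>"
      if p: "(g, \<epsilon>) \<in> P" and \<phi>: "\<phi> \<in> ell_infinity" for g \<epsilon> \<phi>
    proof -
      have "\<bar>vector_mean f (\<lambda>x. \<phi> (- g + x)) - vector_mean f \<phi>\<bar> \<le> 3 * \<delta> * F \<phi>"
        unfolding vector_mean_translate[OF \<phi>] using weighted_diff_le[OF \<phi> F[OF \<phi>], of "translate (- g) f" f \<delta>]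
          f p \<delta> \<phi> by (force simp: vector_mean_def norm_translate)
      also have "\<dots> \<le> \<epsilon> * F \<phi>" using \<delta>P[OF p] F0 by (rule mult_right_mono)
      finally show ?thesis .
    qed
    moreover have "vector_mean f \<in> box"
    proof -
      have "\<bar>vector_mean f \<phi>\<bar> \<le> F \<phi>" for \<phi>
      proof (cases "\<phi> \<in> ell_infinity")
        case True
        thus ?thesis using vector_mean_bound[OF f(1)] F by blast
      qed (use F0 in \<open>simp add: vector_mean_def\<close>)
      thus ?thesis unfolding box_def by (auto simp: abs_le_iff minus_le_iff)
    qed
    ultimately have "vector_mean f \<in> box \<inter> (\<Inter>p\<in>P. almost p)"
      by (auto simp: almost_def)
    thus "box \<inter> (\<Inter>p\<in>P. almost p) \<noteq> {}" by blast
  qed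
  then obtain m where m: "\<And>g \<epsilon>. \<epsilon> > 0 \<Longrightarrow> m \<in> almost (g, \<epsilon>)" by auto
  have "m (\<lambda>x. \<phi> (- g + x)) = m \<phi>" if \<phi>: "\<phi> \<in> ell_infinity" for g \<phi>
  proof -
    have "\<bar>m (\<lambda>x. \<phi> (- g + x)) - m \<phi>\<bar> \<le> 0 + e" if "e > 0" for e
    proof -
      \<comment> \<open>The added 1 avoids division by zero, since \<open>F \<phi>\<close> may
        vanish.\<close>
      have "m \<in> almost (g, e / (F \<phi> + 1))" using m that F0[of \<phi>] by simp
      hence "\<bar>m (\<lambda>x. \<phi> (- g + x)) - m \<phi>\<bar> \<le> e / (F \<phi> + 1) * F \<phi>"
        using \<phi> by (simp add: almost_def)
      also have "\<dots> \<le> e" using that F0[of \<phi>] by (simp add: field_simps)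
      finally show ?thesis by simp
    qed
    hence "\<bar>m (\<lambda>x. \<phi> (- g + x)) - m \<phi>\<bar> \<le> 0" by (rule field_le_epsilon)
    thus ?thesis by simp
  qed
  moreover have "m \<in> means" using m[of 1] by (simp add: almost_def)
  ultimately have "invariant_mean m" by (simp add: invariant_mean_def means_def)
  thus ?thesis unfolding amenable_def by blast
qed

theorem proposition6p1:
  assumes "just_infinite (reduced_cstar :: 'g::group_add op set)"
  shows "simple_cstar (reduced_cstar :: 'g op set) \<or> amenable TYPE('g)"
proof (rule disjCI)
  let ?A = "reduced_cstar :: 'g op set"
  assume namen: "\<not> amenable TYPE('g)"
  \<comment> \<open>Simplicity also demands a nonzero algebra, which infinite dimension
    provides.\<close>
  have "op_span {} = {0 :: 'g op}" by (rule op.span_empty)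
  hence "finite_dim {0 :: 'g op}" unfolding finite_dim_def by blast
  hence ne: "?A \<noteq> {0}" using assms by (auto simp: just_infinite_def)
  have "I = {0} \<or> I = ?A" if I: "closed_ideal ?A I" for I
  proof (rule ccontr)
    assume "\<not> (I = {0} \<or> I = ?A)"
    hence proper: "I \<noteq> ?A" and fin: "finite_dim_quotient ?A I"
      using assms I by (auto simp: just_infinite_def)
    have "amenable TYPE('g)"
    proof (rule amenable_of_almost_invariant_vectors)
      fix S :: "'g set" and \<delta> :: real
      assume "finite S" "\<delta> > 0"
      then obtain f :: "'g ell2" where "norm f = 1" "\<And>s. s \<in> S \<Longrightarrow> norm (translate s f - f) \<le> \<delta>"
        using norm_left_reg_sum_ge[OF I proper fin] almost_invariant_vector[of S \<delta>] by blast
      thus "\<exists>f :: 'g ell2. norm f = 1 \<and> (\<forall>s\<in>S. norm (translate s f - f) \<le> \<delta>)" by blast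
    qed
    thus False using namen by contradiction
  qed
  thus "simple_cstar ?A" using ne by (simp add: simple_cstar_def)
qed

end
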